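(* Let $n\ge 1$, let $\Lambda_1,\dots,\Lambda_{n-1},T,w$ be positive integers and $\lambda$ an integer with $0\le\lambda<w$, and put $N=\Lambda_1\Lambda_2\cdots\Lambda_{n-1}T$. Suppose that a $(\Lambda_1\times\cdots\times\Lambda_{n-1}\times T,w,\lambda)$ OOC exists, and let $\Phi$ denote the largest size $|C|$ of a $(\Lambda_1\times\cdots\times\Lambda_{n-1}\times T,w,\lambda)$ OOC $C$. Then $$\Phi\le\left\lfloor\frac{N}{Tw}\left\lfloor\frac{N-1}{w-1}\left\lfloor\frac{N-2}{w-2}\cdots\left\lfloor\frac{N-\lambda}{w-\lambda}\right\rfloor\cdots\right\rfloor\right\rfloor\right\rfloor .$$ Moreover, if $w^2>N\lambda$, then $$\Phi\le\min\left\{\frac{N}{T},\left\lfloor\frac{\frac{N}{T}(w-\lambda)}{w^2-N\lambda}\right\rfloor\right\}.$$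
   Context: An $n$-dimensional optical orthogonal code ($n$-D OOC) with parameters $(\Lambda_1\times\cdots\times\Lambda_{n-1}\times T,w,\lambda_a,\lambda_c)$ is a nonempty set $C$ of binary ($0/1$) arrays $A=(a_{i_1,\dots,i_n})$, indexed by $0\le i_s\le\Lambda_s-1$ for $1\le s\le n-1$ and $0\le i_n\le T-1$, called codewords, each having exactly $w$ entries equal to $1$, such that (the last subscript being read modulo $T$): (i) for every $A\in C$ and every integer $1\le t\le T-1$, $\sum_{i_1,\dots,i_n}a_{i_1,\dots,i_n}a_{i_1,\dots,i_n+t}\le\lambda_a$; (ii) for all distinct $A,B\in C$ and every integer $0\le t\le T-1$, $\sum_{i_1,\dots,i_n}a_{i_1,\dots,i_n}b_{i_1,\dots,i_n+t}\le\lambda_c$. The sums run over all index tuples. A $(\Lambda_1\times\cdots\times\Lambda_{n-1}\times T,w,\lambda)$ OOC is one with $\lambda_a=\lambda_c=\lambda$. For $n=1$ the array has dimensions $T$ only and $N=T$. In the nested floor expression the factors are $\frac{N-i}{w-i}$ for $i=1,\dots,\lambda$, inside the outer factor $\frac{N}{Tw}$; for $\lambda=0$ it is $\lfloor N/(Tw)\rfloor$. *)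

theory Defs
  imports Complex_Main "HOL-Library.FuncSet"
begin

text \<open>
  The dimensions are given by \<open>n\<close>, a function \<open>\<Lambda>\<close> of which only the values \<open>\<Lambda> 1, \<dots>, \<Lambda> (n - 1)\<close>
  matter, and \<open>T\<close>. Index tuples and arrays are extensional functions, so that two arrays are equal
  iff they have the same entries and the cardinality of a set of arrays is the number of codewords.
\<close>

definition ooc_index :: "nat \<Rightarrow> (nat \<Rightarrow> nat) \<Rightarrow> nat \<Rightarrow> (nat \<Rightarrow> nat) set" where
  "ooc_index n \<Lambda> T = (\<Pi>\<^sub>E s\<in>{1..n}. {0..<(if s = n then T else \<Lambda> s)})"

definition binary_arrays :: "nat \<Rightarrow> (nat \<Rightarrow> nat) \<Rightarrow> nat \<Rightarrow> ((nat \<Rightarrow> nat) \<Rightarrow> nat) set" where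
  "binary_arrays n \<Lambda> T = (ooc_index n \<Lambda> T \<rightarrow>\<^sub>E {0, 1})"

definition correlation ::
  "nat \<Rightarrow> (nat \<Rightarrow> nat) \<Rightarrow> nat \<Rightarrow> ((nat \<Rightarrow> nat) \<Rightarrow> nat) \<Rightarrow> ((nat \<Rightarrow> nat) \<Rightarrow> nat) \<Rightarrow> nat \<Rightarrow> nat" where
  "correlation n \<Lambda> T A B t = (\<Sum>i\<in>ooc_index n \<Lambda> T. A i * B (i(n := (i n + t) mod T)))"

definition is_ooc ::
  "nat \<Rightarrow> (nat \<Rightarrow> nat) \<Rightarrow> nat \<Rightarrow> nat \<Rightarrow> nat \<Rightarrow> nat \<Rightarrow> ((nat \<Rightarrow> nat) \<Rightarrow> nat) set \<Rightarrow> bool" where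
  "is_ooc n \<Lambda> T w la lc C \<longleftrightarrow>
     C \<noteq> {} \<and> C \<subseteq> binary_arrays n \<Lambda> T \<and>
     (\<forall>A\<in>C. card {i \<in> ooc_index n \<Lambda> T. A i = 1} = w) \<and>
     (\<forall>A\<in>C. \<forall>t. 1 \<le> t \<and> t < T \<longrightarrow> correlation n \<Lambda> T A A t \<le> la) \<and>
     (\<forall>A\<in>C. \<forall>B\<in>C. A \<noteq> B \<longrightarrow> (\<forall>t<T. correlation n \<Lambda> T A B t \<le> lc))"

definition ooc_max_size :: "nat \<Rightarrow> (nat \<Rightarrow> nat) \<Rightarrow> nat \<Rightarrow> nat \<Rightarrow> nat \<Rightarrow> nat" where
  "ooc_max_size n \<Lambda> T w l = Max (card ` {C. is_ooc n \<Lambda> T w l l C})"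

text \<open>The two finiteness facts show that the cardinality and the maximum above are the intended ones.\<close>

lemma finite_binary_arrays: "finite (binary_arrays n \<Lambda> T)"
  unfolding binary_arrays_def ooc_index_def by (intro finite_PiE) auto

lemma finite_ooc_codes: "finite {C. is_ooc n \<Lambda> T w la lc C}"
  by (rule finite_subset[of _ "Pow (binary_arrays n \<Lambda> T)"])
    (auto simp: is_ooc_def finite_binary_arrays)

text \<open>
  With \<open>f i x = \<lfloor>(N - i) / (w - i) * x\<rfloor>\<close>, the following is \<open>f 1 (f 2 (\<dots> (f l 1)))\<close>;
  it is \<open>1\<close> for \<open>l = 0\<close>.
\<close>

definition nested_floor :: "nat \<Rightarrow> nat \<Rightarrow> nat \<Rightarrow> int" where
  "nested_floor N w l =
     foldr (\<lambda>i x. \<lfloor>(real N - real i) / (real w - real i) * real_of_int x\<rfloor>) [1..<Suc l] 1"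

end

theory Submission
  imports Defs "HOL-Analysis.Convex"
begin

text \<open>
  Shifting every codeword cyclically by all \<open>t < T\<close> turns a code \<open>C\<close> into a family of \<open>T * card C\<close>
  blocks of size \<open>w\<close> in the set of index tuples, which has \<open>N\<close> points. Shifting both blocks back
  by the same amount shows that the intersection size of any two of these blocks is one of the
  correlations bounded in the definition, so it is at most \<open>l\<close>. All three bounds are therefore \<open>1/T\<close>
  times bounds on the size \<open>M\<close> of a family of \<open>w\<close>-subsets of an \<open>N\<close>-set with pairwise
  intersections of size at most \<open>l\<close>.

  The nested floor is Johnson's bound, by induction on \<open>l\<close>: the blocks through a fixed point
  \<open>x\<close>, with \<open>x\<close> removed, form a family with parameters \<open>N - 1\<close>, \<open>w - 1\<close>, \<open>l - 1\<close>, which bounds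
  the number of blocks through each point by an integer, and counting incidences gives \<open>M * w\<close> as
  the sum of these numbers.

  The other two bounds come from the Cauchy--Schwarz inequality. Applied to the point
  degrees, it gives \<open>(M w)\<^sup>2 \<le> N (M w + M (M - 1) l)\<close>, hence \<open>M (w\<^sup>2 - N l) \<le> N (w - l)\<close>.
  If \<open>M > N\<close>, the incidence vectors of the blocks are linearly dependent; separating the
  positive from the negative coefficients yields two disjointly supported nonnegative combinations
  with the same value \<open>v\<close> and the same total weight \<open>s > 0\<close>. Expanding \<open>v \<bullet> v\<close> with one
  combination on each side involves only distinct blocks, so \<open>v \<bullet> v \<le> l s\<^sup>2\<close>, whereas
  Cauchy--Schwarz gives \<open>(w s)\<^sup>2 \<le> N (v \<bullet> v)\<close>. Thus \<open>w\<^sup>2 > N l\<close> forces \<open>M \<le> N\<close>.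
\<close>

section \<open>Families of blocks with small pairwise intersections\<close>

text \<open>
  The blocks are indexed by \<open>K\<close> rather than collected in a set, so that the \<open>T\<close> shifts of each
  codeword are counted separately without first showing that they are distinct.
\<close>

locale packing =
  fixes K :: "'k set" and X :: "'x set" and S :: "'k \<Rightarrow> 'x set" and w l :: nat
  assumes finite_index: "finite K" and finite_points: "finite X"
    and block_subset: "k \<in> K \<Longrightarrow> S k \<subseteq> X"
    and card_block: "k \<in> K \<Longrightarrow> card (S k) = w"
    and card_Int: "k \<in> K \<Longrightarrow> k' \<in> K \<Longrightarrow> k \<noteq> k' \<Longrightarrow> card (S k \<inter> S k') \<le> l"
begin

lemma sum_weighted_incidences:
  assumes "P \<subseteq> K"
  shows "(\<Sum>x\<in>X. \<Sum>k\<in>P. a k * of_bool (x \<in> S k)) = real w * (\<Sum>k\<in>P. a k)"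
proof -
  have "(\<Sum>x\<in>X. of_bool (x \<in> S k)) = real w" if "k \<in> P" for k
  proof -
    have "X \<inter> S k = S k" using block_subset assms that by blast
    then show ?thesis
      using card_block assms that finite_points by (auto simp: Int_def)
  qed
  then show ?thesis
    by (subst sum.swap) (simp add: sum_distrib_left[symmetric] sum_distrib_right[symmetric] mult.commute)
qed

text \<open>The inner product of two linear combinations of incidence vectors.\<close>

lemma sum_weighted_products:
  assumes "P \<subseteq> K" "Q \<subseteq> K"
  shows "(\<Sum>x\<in>X. (\<Sum>k\<in>P. a k * of_bool (x \<in> S k)) * (\<Sum>k\<in>Q. b k * of_bool (x \<in> S k)))
       = (\<Sum>k\<in>P. \<Sum>k'\<in>Q. a k * b k' * real (card (S k \<inter> S k')))"
proof -
  have *: "(\<Sum>x\<in>X. of_bool (x \<in> S k) * of_bool (x \<in> S k')) = real (card (S k \<inter> S k'))"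
    if "k \<in> P" "k' \<in> Q" for k k'
  proof -
    have "X \<inter> (S k \<inter> S k') = S k \<inter> S k'" using block_subset assms that by blast
    moreover have "(\<Sum>x\<in>X. of_bool (x \<in> S k) * of_bool (x \<in> S k'))
        = (\<Sum>x\<in>X. of_bool (x \<in> S k \<inter> S k') :: real)"
      by (intro sum.cong) auto
    ultimately show ?thesis
      using finite_points by (simp add: Int_def)
  qed
  have "(\<Sum>x\<in>X. (\<Sum>k\<in>P. a k * of_bool (x \<in> S k)) * (\<Sum>k\<in>Q. b k * of_bool (x \<in> S k)))
      = (\<Sum>x\<in>X. \<Sum>k\<in>P. \<Sum>k'\<in>Q. a k * b k' * (of_bool (x \<in> S k) * of_bool (x \<in> S k')))"
    by (simp add: sum_product algebra_simps)
  also have "\<dots> = (\<Sum>k\<in>P. \<Sum>k'\<in>Q. \<Sum>x\<in>X. a k * b k' * (of_bool (x \<in> S k) * of_bool (x \<in> S k')))"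
    by (subst sum.swap, intro sum.cong refl, subst sum.swap, rule refl)
  also have "\<dots> = (\<Sum>k\<in>P. \<Sum>k'\<in>Q. a k * b k' * real (card (S k \<inter> S k')))"
    by (intro sum.cong refl) (simp add: sum_distrib_left[symmetric] *)
  finally show ?thesis .
qed

lemma card_mult_le_of_degree_le:
  assumes "\<And>x. x \<in> X \<Longrightarrow> real (card {k \<in> K. x \<in> S k}) \<le> d"
  shows "real (card K) * real w \<le> real (card X) * d"
proof -
  have "real (card K) * real w = (\<Sum>x\<in>X. \<Sum>k\<in>K. 1 * of_bool (x \<in> S k))"
    by (subst sum_weighted_incidences) auto
  also have "\<dots> = (\<Sum>x\<in>X. real (card {k \<in> K. x \<in> S k}))"
    using finite_index by (simp add: Int_def)
  also have "\<dots> \<le> real (card X) * d"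
    using assms by (intro sum_bounded_above) auto
  finally show ?thesis .
qed

end

text \<open>Two blocks through \<open>x\<close> share \<open>x\<close>, so deleting it lowers the intersection bound by one.\<close>

lemma packing_derived:
  assumes "packing K X S w (Suc l)"
  shows "packing {k \<in> K. x \<in> S k} (X - {x}) (\<lambda>k. S k - {x}) (w - 1) l"
proof -
  interpret packing K X S w "Suc l" by (fact assms)
  show ?thesis
  proof
    fix k k' assume k: "k \<in> {k \<in> K. x \<in> S k}" "k' \<in> {k \<in> K. x \<in> S k}" "k \<noteq> k'"
    have "(S k - {x}) \<inter> (S k' - {x}) = S k \<inter> S k' - {x}" by blast
    moreover have "card (S k \<inter> S k' - {x}) = card (S k \<inter> S k') - 1"
      using k by (intro card_Diff_singleton) auto
    ultimately show "card ((S k - {x}) \<inter> (S k' - {x})) \<le> l"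
      using card_Int[of k k'] k by simp
  qed (use finite_index finite_points block_subset card_block in auto)
qed


section \<open>Johnson's nested bound\<close>

lemma nested_floor_0: "nested_floor N w 0 = 1"
  by (simp add: nested_floor_def)

text \<open>Peeling off the outermost factor leaves the factors \<open>i = 2, \<dots>, l + 1\<close>, which are the factors
  \<open>i = 1, \<dots>, l\<close> for the parameters \<open>N - 1\<close> and \<open>w - 1\<close> of the derived packing.\<close>

lemma nested_floor_Suc:
  assumes "0 < N" "0 < w"
  shows "nested_floor N w (Suc l)
    = \<lfloor>real (N - 1) / real (w - 1) * real_of_int (nested_floor (N - 1) (w - 1) l)\<rfloor>"
proof -
  define f where "f N w = (\<lambda>i x. \<lfloor>(real N - real i) / (real w - real i) * real_of_int x\<rfloor>)" for N w
  have "f N w \<circ> Suc = f (N - 1) (w - 1)"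
    using assms by (auto simp: f_def fun_eq_iff of_nat_diff algebra_simps)
  moreover have "[1..<Suc (Suc l)] = 1 # map Suc [1..<Suc l]"
    by (simp add: map_Suc_upt upt_conv_Cons)
  ultimately have "foldr (f N w) [1..<Suc (Suc l)] 1 = f N w 1 (foldr (f (N - 1) (w - 1)) [1..<Suc l] 1)"
    by (simp only: foldr_map foldr.simps o_apply)
  then show ?thesis
    using assms unfolding nested_floor_def f_def by (simp add: of_nat_diff)
qed

text \<open>The derived packing at a point has the degree of that point as its number of blocks. The
  induction hypothesis bounds this integer, so the bound may be rounded down before the
  incidences are counted; this is where the nested floors come from. For \<open>l = 0\<close> the blocks are
  disjoint and all degrees are at most \<open>1\<close>.\<close>

theorem johnson_bound:
  assumes "packing K X S w l" "l < w" "w \<le> card X"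
  shows "real (card K) * real w \<le> real (card X) * real_of_int (nested_floor (card X) w l)"
  using assms
proof (induction l arbitrary: K X S w)
  case 0
  interpret packing K X S w 0 by (fact 0)
  have "card {k \<in> K. x \<in> S k} \<le> 1" for x
  proof -
    have "k = k'" if k: "k \<in> K" "x \<in> S k" "k' \<in> K" "x \<in> S k'" for k k'
    proof (rule ccontr)
      assume "k \<noteq> k'"
      then have "card (S k \<inter> S k') = 0" using card_Int k by auto
      moreover have "finite (S k)" using block_subset k finite_points finite_subset by blast
      ultimately show False using k by auto
    qed
    then show ?thesis
      using finite_index by (auto simp: card_le_Suc0_iff_eq)
  qed
  then show ?case
    by (intro card_mult_le_of_degree_le) (simp add: nested_floor_0)
next
  case (Suc l)
  interpret packing K X S w "Suc l" by (fact Suc)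
  show ?case
  proof (rule card_mult_le_of_degree_le)
    fix x assume x: "x \<in> X"
    let ?d = "card {k \<in> K. x \<in> S k}"
    have X': "card (X - {x}) = card X - 1" using x by simp
    have "real ?d * real (w - 1)
        \<le> real (card X - 1) * real_of_int (nested_floor (card X - 1) (w - 1) l)"
      using Suc.IH[OF packing_derived[OF Suc.prems(1)], of x] Suc.prems X' by simp
    then have "real ?d
        \<le> real (card X - 1) / real (w - 1) * real_of_int (nested_floor (card X - 1) (w - 1) l)"
      using Suc.prems by (simp add: field_simps)
    then have "int ?d \<le> nested_floor (card X) w (Suc l)"
      using Suc.prems by (subst nested_floor_Suc) (auto simp: le_floor_iff)
    then show "real ?d \<le> real_of_int (nested_floor (card X) w (Suc l))"
      by linarith
  qed
qed


section \<open>Bounds from the Cauchy--Schwarz inequality\<close>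

context packing
begin


text \<open>Given their sum \<open>M w\<close>, the degrees have the least sum of squares when all are equal, namely
  \<open>(M w)\<^sup>2 / N\<close>. On the other hand the sum of their squares is the sum of the intersection sizes
  over all ordered pairs of blocks, which is at most \<open>M w + M (M - 1) l\<close>.\<close>

theorem second_johnson_bound:
  assumes "K \<noteq> {}"
  shows "real (card K) * ((real w)\<^sup>2 - real (card X) * real l) \<le> real (card X) * (real w - real l)"
proof -
  define M N where "M = real (card K)" and "N = real (card X)"
  define d where "d x = (\<Sum>k\<in>K. 1 * of_bool (x \<in> S k) :: real)" for x
  have M: "M > 0" using assms finite_index by (simp add: M_def card_gt_0_iff)
  have row: "(\<Sum>k'\<in>K. 1 * 1 * real (card (S k \<inter> S k'))) \<le> real w + (M - 1) * real l" if "k \<in> K" for k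
  proof -
    have "(\<Sum>k'\<in>K - {k}. real (card (S k \<inter> S k'))) \<le> real (card (K - {k})) * real l"
      using card_Int that by (intro sum_bounded_above) auto
    moreover have "real (card (K - {k})) = M - 1"
      using that finite_index M by (simp add: M_def of_nat_diff)
    ultimately show ?thesis
      using finite_index that card_block by (simp add: sum.remove[where x = k])
  qed
  have "(real w * M)\<^sup>2 = (\<Sum>x\<in>X. d x)\<^sup>2"
    unfolding d_def by (subst sum_weighted_incidences) (simp_all add: M_def)
  also have "\<dots> \<le> (\<Sum>x\<in>X. (d x)\<^sup>2) * N"
    unfolding N_def by (rule sum_squared_le_sum_of_squares)
  also have "(\<Sum>x\<in>X. (d x)\<^sup>2) = (\<Sum>k\<in>K. \<Sum>k'\<in>K. 1 * 1 * real (card (S k \<inter> S k')))"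
    unfolding power2_eq_square d_def by (rule sum_weighted_products) auto
  also have "\<dots> \<le> M * (real w + (M - 1) * real l)"
    unfolding M_def by (intro sum_bounded_above row[unfolded M_def])
  finally have "(real w * M)\<^sup>2 \<le> M * (real w + (M - 1) * real l) * N"
    by (simp add: mult_right_mono N_def)
  then have "M * (M * (real w)\<^sup>2) \<le> M * ((real w + (M - 1) * real l) * N)"
    by (simp add: power2_eq_square algebra_simps)
  then have "M * (real w)\<^sup>2 \<le> (real w + (M - 1) * real l) * N"
    using M by simp
  then show ?thesis
    unfolding M_def[symmetric] N_def[symmetric] by (simp add: algebra_simps)
qed

end

text \<open>More vectors than coordinates are linearly dependent, by Gaussian elimination on one
  coordinate at a time.\<close>

lemma exists_linear_dependency:
  fixes m :: "'x \<Rightarrow> 'k \<Rightarrow> 'a::field"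
  assumes "finite X" "finite K" "card X < card K"
  shows "\<exists>a. (\<exists>k\<in>K. a k \<noteq> 0) \<and> (\<forall>x\<in>X. (\<Sum>k\<in>K. a k * m x k) = 0)"
  using assms
proof (induction X arbitrary: K m rule: finite_induct)
  case empty
  then have "K \<noteq> {}" by auto
  then show ?case by (intro exI[of _ "\<lambda>_. 1"]) auto
next
  case (insert y X)
  show ?case
  proof (cases "\<forall>k\<in>K. m y k = 0")
    case True
    have "card X < card K" using insert by simp
    then obtain a where "\<exists>k\<in>K. a k \<noteq> 0" "\<forall>x\<in>X. (\<Sum>k\<in>K. a k * m x k) = 0"
      using insert.IH[OF insert.prems(1), of m] by blast
    with True show ?thesis by auto
  next
    case False
    then obtain p where p: "p \<in> K" "m y p \<noteq> 0" by auto
    \<comment> \<open>Subtracting a multiple of the column \<open>p\<close> from each column clears the row \<open>y\<close>; the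
      coefficient of \<open>p\<close> in the relation collects these multiples.\<close>
    define m' where "m' x k = m x k - m x p * m y k / m y p" for x k
    have "finite (K - {p})" "card X < card (K - {p})" using insert p by auto
    then obtain a where a: "\<exists>k\<in>K - {p}. a k \<noteq> 0" "\<And>x. x \<in> X \<Longrightarrow> (\<Sum>k\<in>K - {p}. a k * m' x k) = 0"
      using insert.IH[of "K - {p}" m'] by blast
    define b where "b = a(p := - (\<Sum>k\<in>K - {p}. a k * m y k) / m y p)"
    have sum_b: "(\<Sum>k\<in>K. b k * m x k) = (\<Sum>k\<in>K - {p}. a k * m' x k)" for x
    proof -
      have "(\<Sum>k\<in>K. b k * m x k) = b p * m x p + (\<Sum>k\<in>K - {p}. a k * m x k)"
        using insert.prems p by (simp add: sum.remove[of K p] b_def)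
      also have "b p * m x p = - (\<Sum>k\<in>K - {p}. a k * (m x p * m y k / m y p))"
        by (simp add: b_def sum_distrib_left sum_divide_distrib mult_ac)
      also have "\<dots> + (\<Sum>k\<in>K - {p}. a k * m x k) = (\<Sum>k\<in>K - {p}. a k * m' x k)"
        by (simp add: m'_def right_diff_distrib sum_subtractf)
      finally show ?thesis .
    qed
    moreover have "(\<Sum>k\<in>K - {p}. a k * m' y k) = 0"
      using p by (simp add: m'_def)
    moreover have "\<exists>k\<in>K. b k \<noteq> 0" using a(1) by (auto simp: b_def)
    ultimately show ?thesis using a(2) by (intro exI[of _ b]) auto
  qed
qed

text \<open>A nontrivial linear relation among the incidence vectors gives a vector \<open>v\<close> that is a
  nonnegative combination of each of two disjoint sets of blocks, with the same total weight \<open>s\<close>. Inner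
  products of distinct blocks are at most \<open>l\<close>, so \<open>v \<bullet> v \<le> l s\<^sup>2\<close>, which is too small for a vector
  with coordinate sum \<open>w s\<close> if \<open>w\<^sup>2 > N l\<close>.\<close>

theorem (in packing) card_le_of_square_gt:
  assumes "card X * l < w\<^sup>2"
  shows "card K \<le> card X"
proof (rule ccontr)
  assume "\<not> card K \<le> card X"
  then obtain a where a: "\<exists>k\<in>K. a k \<noteq> 0"
    and dep: "\<And>x. x \<in> X \<Longrightarrow> (\<Sum>k\<in>K. a k * (of_bool (x \<in> S k) :: real)) = 0"
    using exists_linear_dependency[OF finite_points finite_index, of "\<lambda>x k. of_bool (x \<in> S k) :: real"]
    by auto
  define P Q where "P = {k \<in> K. a k > 0}" and "Q = {k \<in> K. a k < 0}"
  have sub: "P \<subseteq> K" "Q \<subseteq> K" and disj: "P \<inter> Q = {}" by (auto simp: P_def Q_def)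
  have fin: "finite P" "finite Q" using sub finite_index finite_subset by blast+
  have split: "(\<Sum>k\<in>K. a k * c k) = (\<Sum>k\<in>P. a k * c k) - (\<Sum>k\<in>Q. - a k * c k)" for c
  proof -
    have "(\<Sum>k\<in>K. a k * c k) = (\<Sum>k\<in>P \<union> Q. a k * c k)"
      using finite_index by (intro sum.mono_neutral_right) (auto simp: P_def Q_def)
    then show ?thesis
      using fin disj by (simp add: sum.union_disjoint sum_negf)
  qed
  define v where "v x = (\<Sum>k\<in>P. a k * of_bool (x \<in> S k))" for x
  define s where "s = (\<Sum>k\<in>P. a k)"
  have v: "v x = (\<Sum>k\<in>Q. - a k * of_bool (x \<in> S k))" if "x \<in> X" for x
    using split[of "\<lambda>k. of_bool (x \<in> S k)"] dep[OF that] by (simp only: v_def)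
  have w: "0 < w" using assms by (cases w) auto
  \<comment> \<open>The blocks all have size \<open>w\<close>, so summing the two expressions for \<open>v\<close> over the points shows
    that the two combinations have the same total weight.\<close>
  have "real w * s = (\<Sum>x\<in>X. v x)"
    unfolding v_def s_def by (rule sum_weighted_incidences[symmetric, OF sub(1)])
  also have "\<dots> = (\<Sum>x\<in>X. \<Sum>k\<in>Q. - a k * of_bool (x \<in> S k))"
    using v by (rule sum.cong[OF refl])
  also have "\<dots> = real w * (\<Sum>k\<in>Q. - a k)"
    by (rule sum_weighted_incidences[OF sub(2)])
  finally have s: "s = (\<Sum>k\<in>Q. - a k)" using w by simp
  \<comment> \<open>Since \<open>s\<close> is the total of either set of coefficients, one nonzero coefficient of either
    sign suffices.\<close>
  have "s > 0"
  proof (cases "P = {}")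
    case True
    then have "Q \<noteq> {}" using a by (force simp: P_def Q_def)
    then show ?thesis unfolding s using fin by (intro sum_pos) (auto simp: Q_def)
  next
    case False
    then show ?thesis unfolding s_def using fin by (intro sum_pos) (auto simp: P_def)
  qed
  have "(\<Sum>x\<in>X. (v x)\<^sup>2) = (\<Sum>x\<in>X. v x * (\<Sum>k\<in>Q. - a k * of_bool (x \<in> S k)))"
    using v by (intro sum.cong) (simp_all add: power2_eq_square)
  also have "\<dots> = (\<Sum>k\<in>P. \<Sum>k'\<in>Q. a k * - a k' * real (card (S k \<inter> S k')))"
    unfolding v_def by (rule sum_weighted_products[OF sub])
  also have "\<dots> \<le> (\<Sum>k\<in>P. \<Sum>k'\<in>Q. a k * - a k' * real l)"
  proof (intro sum_mono mult_left_mono)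
    fix k k' assume k: "k \<in> P" "k' \<in> Q"
    then show "real (card (S k \<inter> S k')) \<le> real l"
      using card_Int[of k k'] sub disj by auto
    from k show "0 \<le> a k * - a k'"
      by (intro mult_nonneg_nonneg) (auto simp: P_def Q_def)
  qed
  also have "\<dots> = s * (\<Sum>k\<in>Q. - a k) * real l"
    unfolding s_def sum_product by (simp only: sum_distrib_right)
  also have "\<dots> = s\<^sup>2 * real l"
    by (simp only: s[symmetric] power2_eq_square)
  finally have vv: "(\<Sum>x\<in>X. (v x)\<^sup>2) \<le> s\<^sup>2 * real l" .
  have "(real w * s)\<^sup>2 \<le> (\<Sum>x\<in>X. (v x)\<^sup>2) * real (card X)"
    unfolding \<open>real w * s = (\<Sum>x\<in>X. v x)\<close> by (rule sum_squared_le_sum_of_squares)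
  also have "\<dots> \<le> s\<^sup>2 * real l * real (card X)"
    using vv by (rule mult_right_mono) simp
  finally have "s\<^sup>2 * (real w)\<^sup>2 \<le> s\<^sup>2 * real (card X * l)"
    by (simp add: power_mult_distrib mult_ac)
  then have "real (w\<^sup>2) \<le> real (card X * l)" using \<open>s > 0\<close> by simp
  then show False using assms by linarith
qed


section \<open>The shifts of the codewords\<close>

definition shift :: "nat \<Rightarrow> nat \<Rightarrow> nat \<Rightarrow> (nat \<Rightarrow> nat) \<Rightarrow> nat \<Rightarrow> nat" where
  "shift n T t i = i(n := (i n + t) mod T)"

definition shifted_block ::
  "nat \<Rightarrow> (nat \<Rightarrow> nat) \<Rightarrow> nat \<Rightarrow> ((nat \<Rightarrow> nat) \<Rightarrow> nat) \<times> nat \<Rightarrow> (nat \<Rightarrow> nat) set" where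
  "shifted_block n \<Lambda> T = (\<lambda>(A, t). {i \<in> ooc_index n \<Lambda> T. A (shift n T t i) = 1})"

lemma finite_ooc_index: "finite (ooc_index n \<Lambda> T)"
  unfolding ooc_index_def by (intro finite_PiE) auto

lemma card_ooc_index:
  assumes "n \<ge> 1"
  shows "card (ooc_index n \<Lambda> T) = (\<Prod>s=1..n - 1. \<Lambda> s) * T"
proof -
  have "{1..n} = insert n {1..n - 1}" using assms by auto
  moreover have "(\<Prod>s\<in>{1..n - 1}. if s = n then T else \<Lambda> s) = (\<Prod>s=1..n - 1. \<Lambda> s)"
    using assms by (intro prod.cong) auto
  ultimately show ?thesis
    using assms by (simp add: ooc_index_def card_PiE mult.commute)
qed

lemma shift_shift: "shift n T t (shift n T s i) = shift n T (s + t) i"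
  by (simp add: shift_def mod_add_left_eq add.assoc)

lemma shift_in_ooc_index:
  assumes "n \<ge> 1" "T > 0" "i \<in> ooc_index n \<Lambda> T"
  shows "shift n T t i \<in> ooc_index n \<Lambda> T"
  using assms unfolding ooc_index_def shift_def
  by (auto simp: PiE_iff extensional_def)

lemma shift_period:
  assumes "n \<ge> 1" "i \<in> ooc_index n \<Lambda> T"
  shows "shift n T T i = i"
proof -
  have "i n < T" using assms by (force simp: ooc_index_def PiE_iff)
  then show ?thesis by (simp add: shift_def)
qed

lemma bij_betw_shift:
  assumes "n \<ge> 1" "t < T"
  shows "bij_betw (shift n T t) (ooc_index n \<Lambda> T) (ooc_index n \<Lambda> T)"
proof (rule bij_betw_byWitness[where f' = "shift n T (T - t)"])
  have "t + (T - t) = T" "T - t + t = T" using assms by auto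
  then show "\<forall>i\<in>ooc_index n \<Lambda> T. shift n T (T - t) (shift n T t i) = i"
    and "\<forall>i\<in>ooc_index n \<Lambda> T. shift n T t (shift n T (T - t) i) = i"
    using shift_period[OF assms(1)] by (simp_all only: shift_shift) blast+
  have "T > 0" using assms by simp
  then show "shift n T t ` ooc_index n \<Lambda> T \<subseteq> ooc_index n \<Lambda> T"
    and "shift n T (T - t) ` ooc_index n \<Lambda> T \<subseteq> ooc_index n \<Lambda> T"
    using shift_in_ooc_index[OF assms(1)] by blast+
qed

text \<open>The predicate \<open>p\<close> allows two uses: a shifted codeword keeps its weight, and two blocks shifted
  by the same amount keep the size of their intersection.\<close>

lemma card_shifted:
  assumes "n \<ge> 1" "t < T"
  shows "card {i \<in> ooc_index n \<Lambda> T. p (shift n T t i)} = card {i \<in> ooc_index n \<Lambda> T. p i}"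
  by (rule bij_betw_same_card[OF bij_betw_Collect[OF bij_betw_shift[OF assms]]]) simp

lemma correlation_eq_card:
  assumes "n \<ge> 1" "T > 0" "A \<in> binary_arrays n \<Lambda> T" "B \<in> binary_arrays n \<Lambda> T"
  shows "correlation n \<Lambda> T A B t = card {i \<in> ooc_index n \<Lambda> T. A i = 1 \<and> B (shift n T t i) = 1}"
proof -
  have "A i * B (shift n T t i) = of_bool (A i = 1 \<and> B (shift n T t i) = 1)"
    if "i \<in> ooc_index n \<Lambda> T" for i
  proof -
    have "A i \<in> {0, 1}" "B (shift n T t i) \<in> {0, 1}"
      using assms that shift_in_ooc_index unfolding binary_arrays_def by blast+
    then show ?thesis by auto
  qed
  then have "correlation n \<Lambda> T A B t
      = (\<Sum>i\<in>ooc_index n \<Lambda> T. of_bool (A i = 1 \<and> B (shift n T t i) = 1))"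
    unfolding correlation_def shift_def[symmetric] by (rule sum.cong[OF refl])
  then show ?thesis
    using finite_ooc_index by (simp add: Int_def)
qed

lemma card_Int_shifted_block:
  assumes "n \<ge> 1" "A \<in> binary_arrays n \<Lambda> T" "B \<in> binary_arrays n \<Lambda> T" "s \<le> t" "t < T"
  shows "card (shifted_block n \<Lambda> T (A, s) \<inter> shifted_block n \<Lambda> T (B, t)) = correlation n \<Lambda> T A B (t - s)"
proof -
  have "shifted_block n \<Lambda> T (A, s) \<inter> shifted_block n \<Lambda> T (B, t)
      = {i \<in> ooc_index n \<Lambda> T. A (shift n T s i) = 1 \<and> B (shift n T (t - s) (shift n T s i)) = 1}"
    using assms by (auto simp: shifted_block_def shift_shift)
  then have "card (shifted_block n \<Lambda> T (A, s) \<inter> shifted_block n \<Lambda> T (B, t))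
      = card {i \<in> ooc_index n \<Lambda> T. A (shift n T s i) = 1 \<and> B (shift n T (t - s) (shift n T s i)) = 1}"
    by (rule arg_cong)
  also have "\<dots> = card {i \<in> ooc_index n \<Lambda> T. A i = 1 \<and> B (shift n T (t - s) i) = 1}"
    by (rule card_shifted[where p = "\<lambda>i. A i = 1 \<and> B (shift n T (t - s) i) = 1"]) (use assms in auto)
  also have "\<dots> = correlation n \<Lambda> T A B (t - s)"
    by (rule correlation_eq_card[symmetric]) (use assms in auto)
  finally show ?thesis .
qed

text \<open>For two shifts of the same codeword, the difference of the shifts is positive and below \<open>T\<close>,
  so the autocorrelation bound applies; for shifts of different codewords, the cross-correlation
  bound applies also when the difference is zero.\<close>

lemma packing_shifted_blocks:
  assumes "is_ooc n \<Lambda> T w l l C" "n \<ge> 1"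
  shows "packing (C \<times> {..<T}) (ooc_index n \<Lambda> T) (shifted_block n \<Lambda> T) w l"
proof
  have C: "C \<subseteq> binary_arrays n \<Lambda> T"
    and weight: "\<And>A. A \<in> C \<Longrightarrow> card {i \<in> ooc_index n \<Lambda> T. A i = 1} = w"
    and auto: "\<And>A t. A \<in> C \<Longrightarrow> 1 \<le> t \<Longrightarrow> t < T \<Longrightarrow> correlation n \<Lambda> T A A t \<le> l"
    and cross: "\<And>A B t. A \<in> C \<Longrightarrow> B \<in> C \<Longrightarrow> A \<noteq> B \<Longrightarrow> t < T \<Longrightarrow> correlation n \<Lambda> T A B t \<le> l"
    using assms(1) unfolding is_ooc_def by blast+
  show "finite (C \<times> {..<T})"
    using C finite_binary_arrays finite_subset by blast
  show "finite (ooc_index n \<Lambda> T)" by (rule finite_ooc_index)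
  fix k assume k: "k \<in> C \<times> {..<T}"
  show "shifted_block n \<Lambda> T k \<subseteq> ooc_index n \<Lambda> T"
    by (auto simp: shifted_block_def split: prod.splits)
  show "card (shifted_block n \<Lambda> T k) = w"
    using k weight card_shifted[OF assms(2), of "snd k" T \<Lambda> "\<lambda>i. fst k i = 1"]
    by (simp add: shifted_block_def case_prod_beta mem_Times_iff)
  fix k' assume k': "k' \<in> C \<times> {..<T}" "k \<noteq> k'"
  have *: "card (shifted_block n \<Lambda> T (A, s) \<inter> shifted_block n \<Lambda> T (B, t)) \<le> l"
    if "A \<in> C" "B \<in> C" "s \<le> t" "t < T" "(A, s) \<noteq> (B, t)" for A B s t
  proof -
    have "correlation n \<Lambda> T A B (t - s) \<le> l"
    proof (cases "A = B")
      case True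
      have "1 \<le> t - s" "t - s < T" using True that by auto
      with True that(1) auto show ?thesis by blast
    next
      case False
      have "t - s < T" using that by auto
      with False that(1,2) cross show ?thesis by blast
    qed
    moreover have "A \<in> binary_arrays n \<Lambda> T" "B \<in> binary_arrays n \<Lambda> T" using C that by auto
    ultimately show ?thesis
      using card_Int_shifted_block[OF assms(2)] that(3,4) by simp
  qed
  obtain A s B t where AB: "k = (A, s)" "k' = (B, t)" by (cases k, cases k')
  show "card (shifted_block n \<Lambda> T k \<inter> shifted_block n \<Lambda> T k') \<le> l"
  proof (cases "s \<le> t")
    case True
    show ?thesis unfolding AB by (rule *) (use True k k' AB in auto)
  next
    case False
    show ?thesis unfolding AB by (subst Int_commute, rule *) (use False k k' AB in auto)
  qed
qed

lemma ooc_max_size_attained: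
  assumes "\<exists>C. is_ooc n \<Lambda> T w l l C"
  obtains C where "is_ooc n \<Lambda> T w l l C" "card C = ooc_max_size n \<Lambda> T w l"
proof -
  have "ooc_max_size n \<Lambda> T w l \<in> card ` {C. is_ooc n \<Lambda> T w l l C}"
    unfolding ooc_max_size_def using assms finite_ooc_codes by (intro Max_in) auto
  then show ?thesis using that by auto
qed


section \<open>The bounds for optical orthogonal codes\<close>

theorem theorem1p2:
  fixes n T w l N :: nat and \<Lambda> :: "nat \<Rightarrow> nat"
  assumes "n \<ge> 1"
    and "\<And>s. s \<in> {1..n - 1} \<Longrightarrow> \<Lambda> s > 0"
    and "T > 0" and "w > 0" and "l < w"
    and "N = (\<Prod>s=1..n - 1. \<Lambda> s) * T"
    and "\<exists>C. is_ooc n \<Lambda> T w l l C"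
  shows "int (ooc_max_size n \<Lambda> T w l)
           \<le> \<lfloor>real N / (real T * real w) * real_of_int (nested_floor N w l)\<rfloor>
         \<and> (w\<^sup>2 > N * l \<longrightarrow>
           real (ooc_max_size n \<Lambda> T w l)
             \<le> min (real N / real T)
                  (real_of_int \<lfloor>(real N / real T) * (real w - real l) / ((real w)\<^sup>2 - real N * real l)\<rfloor>))"
proof -
  obtain C where C: "is_ooc n \<Lambda> T w l l C" and size: "card C = ooc_max_size n \<Lambda> T w l"
    using assms(7) by (rule ooc_max_size_attained)
  interpret packing "C \<times> {..<T}" "ooc_index n \<Lambda> T" "shifted_block n \<Lambda> T" w l
    by (rule packing_shifted_blocks[OF C assms(1)])
  have N: "card (ooc_index n \<Lambda> T) = N"
    using assms by (simp add: card_ooc_index)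
  have M: "card (C \<times> {..<T}) = card C * T" by (simp add: card_cartesian_product)
  have ne: "C \<times> {..<T} \<noteq> {}" using C assms(3) by (auto simp: is_ooc_def)
  have "w \<le> N"
    using ne block_subset card_block card_mono[OF finite_points] N by (metis all_not_in_conv)
  then have "real (card C * T) * real w \<le> real N * real_of_int (nested_floor N w l)"
    using johnson_bound[OF packing_axioms assms(5)] by (simp add: N M)
  then have 1: "real (card C) \<le> real N / (real T * real w) * real_of_int (nested_floor N w l)"
    using assms(3,4) by (simp add: field_simps)
  have 2: "real (card C) \<le> min (real N / real T)
      (real_of_int \<lfloor>(real N / real T) * (real w - real l) / ((real w)\<^sup>2 - real N * real l)\<rfloor>)"
    if "w\<^sup>2 > N * l"
  proof -
    have "real (w\<^sup>2) > real (N * l)" using that by (simp only: of_nat_less_iff)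
    then have pos: "(real w)\<^sup>2 - real N * real l > 0" by simp
    have "card C * T \<le> N" using card_le_of_square_gt that by (simp add: N M)
    then have "real (card C * T) \<le> real N" by (simp only: of_nat_le_iff)
    then have "real (card C) \<le> real N / real T" using assms(3) by (simp add: field_simps)
    moreover have "real (card C * T) * ((real w)\<^sup>2 - real N * real l) \<le> real N * (real w - real l)"
      using second_johnson_bound[OF ne] by (simp only: N M)
    then have "real (card C) \<le> (real N / real T) * (real w - real l) / ((real w)\<^sup>2 - real N * real l)"
      using pos assms(3) by (simp add: pos_le_divide_eq mult_ac)
    then have "int (card C) \<le> \<lfloor>(real N / real T) * (real w - real l) / ((real w)\<^sup>2 - real N * real l)\<rfloor>"
      by (simp add: le_floor_iff)
    ultimately show ?thesis by linarith
  qed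
  show ?thesis
    using 1 2 by (simp add: size[symmetric] le_floor_iff)
qed

end
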